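(* Let $\langle X_*,f_*\rangle$ be an inverse sequence of metric compacta $X_n$ and continuous maps $f_n\colon X_{n+1}\to X_n$ ($n\in\omega$), with limit $\langle X_\infty,f_{*,\infty}\rangle$. The following conditions are equivalent. (i) $X_\infty$ is hereditarily indecomposable. (ii) $X_\infty$ is crooked. (iii) Every map $f_{n,\infty}\colon X_\infty\to X_n$, $n\in\omega$, is crooked. (iv) For every $n\in\omega$, every $\varepsilon>0$, and every pair of closed sets $A,B\subseteq X_n$ there is $m\ge n$ such that $f_{n,m}$ is $\varepsilon$-crooked at $\langle A,B\rangle$. (v) $f_*$ is a crooked sequence, i.e. for every $n\in\omega$ and $\varepsilon>0$ there is $m\ge n$ such that $f_{n,m}$ is $\varepsilon$-crooked.
   Context: A metric compactum is a compact metric space. For $n\le m$ we write $f_{n,m}=f_n\circ f_{n+1}\circ\cdots\circ f_{m-1}\colon X_m\to X_n$ (with $f_{n,n}=\mathrm{id}$). The limit is the topological inverse limit $X_\infty$ with the projections $f_{n,\infty}\colon X_\infty\to X_n$. A continuum is a (non-empty) connected Hausdorff compactum. A Hausdorff compactum $X$ is hereditarily indecomposable if for all subcontinua $C,D\subseteq X$ we have $C\subseteq D$ or $D\subseteq C$ or $C\cap D=\emptyset$. Crookedness. Let $A,B,U_A,U_B$ be subsets of a Hausdorff compactum $X$. The quadruple $\langle A,B,U_A,U_B\rangle$ is admissible if $A,B$ are closed and $U_A,U_B$ are open neighborhoods of $A$ and $B$, respectively. The space $X$ is crooked at the (not necessarily admissible) quadruple $\langle A,B,U_A,U_B\rangle$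 if there is a cover $X=F_A\cup H\cup F_B$ by closed sets such that $A\subseteq F_A$, $B\subseteq F_B$, $F_A\cap H\subseteq U_B$, $F_B\cap H\subseteq U_A$, and $F_A\cap F_B\subseteq U_A\cap U_B$. The space $X$ is crooked if it is crooked at every admissible quadruple. A continuous map $f\colon X\to Y$ between Hausdorff compacta is crooked at a quadruple $\langle A,B,U_A,U_B\rangle$ of subsets of $Y$ if $X$ is crooked at $\langle f^{-1}[A],f^{-1}[B],f^{-1}[U_A],f^{-1}[U_B]\rangle$; $f$ is crooked if it is crooked at every admissible quadruple in $Y$. If $Y$ is metric and $\varepsilon>0$, then $f$ is $\varepsilon$-crooked at $\langle A,B\rangle$ if it is crooked at $\langle A,B,N_\varepsilon(A),N_\varepsilon(B)\rangle$, where $N_\varepsilon(A)=\{y\in Y: d(y,A)<\varepsilon\}$ (with $N_\varepsilon(\emptyset)=\emptyset$). The map $f$ is $\varepsilon$-crooked if it is $\varepsilon$-crooked at every pair $\langle A,B\rangle$ of closed subsets of $Y$. *)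

theory Defs
  imports "HOL-Analysis.Analysis"
begin

definition continuum :: "'a topology \<Rightarrow> bool" where
  "continuum X \<longleftrightarrow>
     topspace X \<noteq> {} \<and> compact_space X \<and> Hausdorff_space X \<and> connected_space X"

definition subcontinuum :: "'a topology \<Rightarrow> 'a set \<Rightarrow> bool" where
  "subcontinuum X C \<longleftrightarrow> C \<subseteq> topspace X \<and> continuum (subtopology X C)"

definition hereditarily_indecomposable :: "'a topology \<Rightarrow> bool" where
  "hereditarily_indecomposable X \<longleftrightarrow>
     (\<forall>C D. subcontinuum X C \<longrightarrow> subcontinuum X D \<longrightarrow> C \<subseteq> D \<or> D \<subseteq> C \<or> C \<inter> D = {})"

definition admissible :: "'a topology \<Rightarrow> 'a set \<Rightarrow> 'a set \<Rightarrow> 'a set \<Rightarrow> 'a set \<Rightarrow> bool" where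
  "admissible X A B U\<^sub>A U\<^sub>B \<longleftrightarrow>
     closedin X A \<and> closedin X B \<and> openin X U\<^sub>A \<and> openin X U\<^sub>B \<and> A \<subseteq> U\<^sub>A \<and> B \<subseteq> U\<^sub>B"

definition crooked_at :: "'a topology \<Rightarrow> 'a set \<Rightarrow> 'a set \<Rightarrow> 'a set \<Rightarrow> 'a set \<Rightarrow> bool" where
  "crooked_at X A B U\<^sub>A U\<^sub>B \<longleftrightarrow>
     (\<exists>F\<^sub>A H F\<^sub>B. closedin X F\<^sub>A \<and> closedin X H \<and> closedin X F\<^sub>B \<and>
        topspace X = F\<^sub>A \<union> H \<union> F\<^sub>B \<and> A \<subseteq> F\<^sub>A \<and> B \<subseteq> F\<^sub>B \<and>
        F\<^sub>A \<inter> H \<subseteq> U\<^sub>B \<and> F\<^sub>B \<inter> H \<subseteq> U\<^sub>A \<and> F\<^sub>A \<inter> F\<^sub>B \<subseteq> U\<^sub>A \<inter> U\<^sub>B)"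

definition crooked_space :: "'a topology \<Rightarrow> bool" where
  "crooked_space X \<longleftrightarrow> (\<forall>A B U\<^sub>A U\<^sub>B. admissible X A B U\<^sub>A U\<^sub>B \<longrightarrow> crooked_at X A B U\<^sub>A U\<^sub>B)"

text \<open>The notions for maps below do not include continuity of the map. Preimages are taken
  within the carrier of the domain.\<close>

definition crooked_map_at ::
    "'a topology \<Rightarrow> ('a \<Rightarrow> 'b) \<Rightarrow> 'b set \<Rightarrow> 'b set \<Rightarrow> 'b set \<Rightarrow> 'b set \<Rightarrow> bool" where
  "crooked_map_at X f A B U\<^sub>A U\<^sub>B \<longleftrightarrow>
     crooked_at X {x \<in> topspace X. f x \<in> A} {x \<in> topspace X. f x \<in> B}
       {x \<in> topspace X. f x \<in> U\<^sub>A} {x \<in> topspace X. f x \<in> U\<^sub>B}"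

definition crooked_map :: "'a topology \<Rightarrow> 'b topology \<Rightarrow> ('a \<Rightarrow> 'b) \<Rightarrow> bool" where
  "crooked_map X Y f \<longleftrightarrow>
     (\<forall>A B U\<^sub>A U\<^sub>B. admissible Y A B U\<^sub>A U\<^sub>B \<longrightarrow> crooked_map_at X f A B U\<^sub>A U\<^sub>B)"

text \<open>The distance to the empty set counts as infinite, so the neighbourhood of the empty set
  is empty; a real-valued infimum over the empty set has to be excluded explicitly.\<close>

definition set_nbhd :: "'a metric \<Rightarrow> real \<Rightarrow> 'a set \<Rightarrow> 'a set" where
  "set_nbhd Y \<epsilon> A = {y \<in> mspace Y. A \<noteq> {} \<and> (INF a\<in>A. mdist Y y a) < \<epsilon>}"

definition eps_crooked_at ::
    "'a topology \<Rightarrow> 'b metric \<Rightarrow> ('a \<Rightarrow> 'b) \<Rightarrow> real \<Rightarrow> 'b set \<Rightarrow> 'b set \<Rightarrow> bool" where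
  "eps_crooked_at X Y f \<epsilon> A B \<longleftrightarrow> crooked_map_at X f A B (set_nbhd Y \<epsilon> A) (set_nbhd Y \<epsilon> B)"

definition eps_crooked :: "'a topology \<Rightarrow> 'b metric \<Rightarrow> ('a \<Rightarrow> 'b) \<Rightarrow> real \<Rightarrow> bool" where
  "eps_crooked X Y f \<epsilon> \<longleftrightarrow>
     (\<forall>A B. closedin (mtopology_of Y) A \<longrightarrow> closedin (mtopology_of Y) B \<longrightarrow>
        eps_crooked_at X Y f \<epsilon> A B)"

text \<open>The spaces of a sequence are carriers inside one arbitrary type, each with its own metric.\<close>

definition inverse_sequence :: "(nat \<Rightarrow> 'a metric) \<Rightarrow> (nat \<Rightarrow> 'a \<Rightarrow> 'a) \<Rightarrow> bool" where
  "inverse_sequence X f \<longleftrightarrow>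
     (\<forall>n. compact_space (mtopology_of (X n)) \<and>
          continuous_map (mtopology_of (X (Suc n))) (mtopology_of (X n)) (f n))"

text \<open>For \<open>n \<le> m\<close> this is \<open>f n \<circ> f (n + 1) \<circ> \<dots> \<circ> f (m - 1)\<close>, a map from space \<open>m\<close> to space \<open>n\<close>.\<close>

definition bonding_map :: "(nat \<Rightarrow> 'a \<Rightarrow> 'a) \<Rightarrow> nat \<Rightarrow> nat \<Rightarrow> 'a \<Rightarrow> 'a" where
  "bonding_map f n m = foldr (\<circ>) (map f [n..<m]) id"

text \<open>The projection to the \<open>n\<close>-th space is evaluation at \<open>n\<close>.\<close>

definition inverse_limit ::
    "(nat \<Rightarrow> 'a metric) \<Rightarrow> (nat \<Rightarrow> 'a \<Rightarrow> 'a) \<Rightarrow> (nat \<Rightarrow> 'a) topology" where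
  "inverse_limit X f =
     subtopology (product_topology (\<lambda>n. mtopology_of (X n)) UNIV) {x. \<forall>n. f n (x (Suc n)) = x n}"

definition limit_projection :: "nat \<Rightarrow> (nat \<Rightarrow> 'a) \<Rightarrow> 'a" where
  "limit_projection n x = x n"

definition crooked_sequence :: "(nat \<Rightarrow> 'a metric) \<Rightarrow> (nat \<Rightarrow> 'a \<Rightarrow> 'a) \<Rightarrow> bool" where
  "crooked_sequence X f \<longleftrightarrow>
     (\<forall>n. \<forall>\<epsilon>>0. \<exists>m\<ge>n. eps_crooked (mtopology_of (X m)) (X n) (bonding_map f n m) \<epsilon>)"

end

theory Submission
  imports Defs
begin

text \<open>Let \<open>A\<close>, \<open>B\<close> be closed, with neighbourhoods \<open>U\<^sub>A\<close>, \<open>U\<^sub>B\<close>, in a hereditarily indecomposable compactum.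
  A component of the complement of \<open>U\<^sub>B\<close> that meets \<open>A\<close> is disjoint from every component of the complement of
  \<open>U\<^sub>A\<close> that meets \<open>B\<close>, because neither can contain the other. Components of a compactum are quasi-components,
  so disjoint clopen pieces \<open>E\<close> and \<open>G\<close> of the two complements contain all components of the first and of the
  second kind; suitable closed neighbourhoods of \<open>A \<union> E\<close> and \<open>B \<union> G\<close> are \<open>F\<^sub>A\<close> and \<open>F\<^sub>B\<close>. Conversely,
  crookedness at \<open>\<langle>{c}, {d}, - D, - C\<rangle>\<close> excludes that \<open>C\<close> and \<open>D\<close> meet when \<open>c \<in> C - D\<close> and \<open>d \<in> D - C\<close>.

  Compactness carries crookedness between the limit and the sequence: every admissible quadruple of the limit is
  refined by one pulled back from a single \<open>X\<^sub>m\<close>, and a closed subset of \<open>X\<^sub>m\<close> that misses the image of the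
  limit misses the image of some \<open>X\<^sub>k\<close>. The index in the last condition can be chosen uniformly because finitely
  many closed sets approximate all closed subsets of \<open>X\<^sub>n\<close>, and crookedness passes to later indices.\<close>

subsection \<open>Crookedness and hereditary indecomposability\<close>

lemma crooked_at_mono:
  assumes "crooked_at X A B U V" "A' \<subseteq> A" "B' \<subseteq> B" "U \<subseteq> U'" "V \<subseteq> V'"
  shows "crooked_at X A' B' U' V'"
proof -
  obtain F H G where "closedin X F" "closedin X H" "closedin X G" "topspace X = F \<union> H \<union> G"
    "A \<subseteq> F" "B \<subseteq> G" "F \<inter> H \<subseteq> V" "G \<inter> H \<subseteq> U" "F \<inter> G \<subseteq> U \<inter> V"
    using assms(1) unfolding crooked_at_def by (elim exE conjE) (rule that)
  moreover from this assms have "A' \<subseteq> F" "B' \<subseteq> G" "F \<inter> H \<subseteq> V'" "G \<inter> H \<subseteq> U'" "F \<inter> G \<subseteq> U' \<inter> V'"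
    by auto
  ultimately show ?thesis
    unfolding crooked_at_def by metis
qed

lemma crooked_map_at_mono:
  assumes "crooked_map_at X f A B U V" "A' \<subseteq> A" "B' \<subseteq> B" "U \<subseteq> U'" "V \<subseteq> V'"
  shows "crooked_map_at X f A' B' U' V'"
  using assms(1) unfolding crooked_map_at_def
  by (rule crooked_at_mono) (use assms(2-) in auto)

text \<open>The closed cover of \<open>X\<close> pulls back along \<open>g\<close>. Agreement of
  \<open>h\<close> with the composite is asked only on the carrier, because the projections of the
  limit satisfy such identities only at threads.\<close>

lemma crooked_map_at_compose:
  assumes "crooked_map_at X f A B U V" and g: "continuous_map Z X g"
    and h: "\<And>z. z \<in> topspace Z \<Longrightarrow> h z = f (g z)"
  shows "crooked_map_at Z h A B U V"
proof -
  let ?p = "\<lambda>S. {x \<in> topspace X. f x \<in> S}" and ?q = "\<lambda>S. {z \<in> topspace Z. g z \<in> S}"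
  have gX: "g z \<in> topspace X" if "z \<in> topspace Z" for z
    using g that by (auto simp: continuous_map_def)
  obtain F H G where c: "closedin X F" "closedin X H" "closedin X G"
    and s: "topspace X = F \<union> H \<union> G" "?p A \<subseteq> F" "?p B \<subseteq> G"
      "F \<inter> H \<subseteq> ?p V" "G \<inter> H \<subseteq> ?p U" "F \<inter> G \<subseteq> ?p U \<inter> ?p V"
    using assms(1) unfolding crooked_map_at_def crooked_at_def by (elim exE conjE) (rule that)
  show ?thesis
    unfolding crooked_map_at_def crooked_at_def
  proof (intro exI conjI)
    show "closedin Z (?q F)" "closedin Z (?q H)" "closedin Z (?q G)"
      using c g by (auto intro: closedin_continuous_map_preimage)
    show "topspace Z = ?q F \<union> ?q H \<union> ?q G"
      using gX s(1) by blast
  qed (use gX h s(2-) in auto)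
qed

lemma crooked_space_imp_hereditarily_indecomposable:
  assumes H: "Hausdorff_space X" and cr: "crooked_space X"
  shows "hereditarily_indecomposable X"
  unfolding hereditarily_indecomposable_def
proof (intro allI impI, rule ccontr)
  fix C D
  assume C: "subcontinuum X C" and D: "subcontinuum X D"
    and "\<not> (C \<subseteq> D \<or> D \<subseteq> C \<or> C \<inter> D = {})"
  then obtain c d z where cdz: "c \<in> C" "c \<notin> D" "d \<in> D" "d \<notin> C" "z \<in> C" "z \<in> D"
    by blast
  have CX: "C \<subseteq> topspace X" "compactin X C" "connectedin X C"
    and DX: "D \<subseteq> topspace X" "compactin X D" "connectedin X D"
    using C D by (auto simp: subcontinuum_def continuum_def compactin_subspace connectedin_def)
  have cl: "closedin X C" "closedin X D"
    using CX DX H compactin_imp_closedin by auto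
  have "admissible X {c} {d} (topspace X - D) (topspace X - C)"
    unfolding admissible_def
    using cdz CX DX cl H by (auto intro: closedin_Hausdorff_singleton)
  then obtain F K G where c: "closedin X F" "closedin X K" "closedin X G"
    and s: "topspace X = F \<union> K \<union> G" "{c} \<subseteq> F" "{d} \<subseteq> G"
      "F \<inter> K \<subseteq> topspace X - C" "G \<inter> K \<subseteq> topspace X - D"
      "F \<inter> G \<subseteq> (topspace X - D) \<inter> (topspace X - C)"
    using cr unfolding crooked_space_def crooked_at_def by metis
  have split: "E \<inter> S = {} \<or> E' \<inter> S = {}"
    if "connectedin X S" "closedin X E" "closedin X E'" "S \<subseteq> E \<union> E'" "E \<inter> E' \<inter> S = {}" for S E E'
    using that unfolding connectedin_closedin by blast
  \<comment> \<open>Both \<open>F \<inter> K\<close> and \<open>F \<inter> G\<close> miss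
    \<open>C\<close>, so \<open>F\<close> and \<open>K \<union> G\<close> would disconnect
    \<open>C\<close> unless one of them misses it; as \<open>c\<close> lies in \<open>F\<close>, it
    is \<open>K \<union> G\<close>.\<close>
  have "F \<inter> C = {} \<or> (K \<union> G) \<inter> C = {}"
    by (rule split) (use CX c s in auto)
  then have "z \<notin> G"
    using cdz s(2) by auto
  moreover have "G \<inter> D = {} \<or> (K \<union> F) \<inter> D = {}"
    by (rule split) (use DX c s in auto)
  then have "z \<notin> K \<union> F"
    using cdz s(3) by auto
  ultimately show False
    using cdz s(1) CX by blast
qed

text \<open>If a point lay in all clopen subsets of \<open>P\<close> around \<open>A \<inter> P\<close> and in all clopen subsets of \<open>Q\<close> around
  \<open>B \<inter> Q\<close>, its components in \<open>P\<close> and \<open>Q\<close> would meet \<open>A\<close> and \<open>B\<close>; being nested, one of them would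
  violate \<open>A \<inter> Q = {}\<close> or \<open>B \<inter> P = {}\<close>.\<close>

lemma separated_clopen_sets:
  assumes cpt: "compact_space X" and H: "Hausdorff_space X" and hi: "hereditarily_indecomposable X"
    and PQ: "closedin X P" "closedin X Q" and AB: "closedin X A" "closedin X B"
    and disj: "A \<inter> Q = {}" "B \<inter> P = {}"
  obtains E G where
    "closedin (subtopology X P) E" "openin (subtopology X P) E" "A \<inter> P \<subseteq> E"
    "closedin (subtopology X Q) G" "openin (subtopology X Q) G" "B \<inter> Q \<subseteq> G" "E \<inter> G = {}"
proof -
  define \<E> where "\<E> = (\<lambda>P A. {E. closedin (subtopology X P) E \<and> openin (subtopology X P) E \<and> A \<inter> P \<subseteq> E})"
  \<comment> \<open>The factor \<open>topspace (subtopology X P)\<close> makes the empty family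
    yield the whole carrier of the subspace instead of \<open>UNIV\<close>.\<close>
  have Int: "\<Inter>\<F> \<inter> topspace (subtopology X P) \<in> \<E> P A"
    if "finite \<F>" "\<F> \<subseteq> \<E> P A" "closedin X A" for \<F> P A
    using that
  proof (induction \<F> rule: finite_induct)
    case empty
    then show ?case
      using closedin_topspace[of "subtopology X P"] openin_topspace[of "subtopology X P"]
      by (auto simp: \<E>_def dest: closedin_subset)
  next
    case (insert E \<F>)
    have "E \<in> \<E> P A" "\<Inter>\<F> \<inter> topspace (subtopology X P) \<in> \<E> P A"
      using insert by auto
    then have "E \<inter> (\<Inter>\<F> \<inter> topspace (subtopology X P)) \<in> \<E> P A"
      unfolding \<E>_def by blast
    then show ?case
      by (simp add: Int_ac)
  qed
  \<comment> \<open>A point in all these clopen sets is not separated from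
    \<open>A \<inter> P\<close>, hence, by compactness, not from some single \<open>a\<close> in it.
    It then lies in the quasi-component of \<open>a\<close>, which in a compact Hausdorff space is
    the component.\<close>
  have component: "\<exists>C. subcontinuum X C \<and> x \<in> C \<and> C \<subseteq> P \<and> C \<inter> A \<noteq> {}"
    if P: "closedin X P" and A: "closedin X A" and x: "x \<in> \<Inter>(\<E> P A)" for P A x
  proof -
    let ?P = "subtopology X P"
    have top: "topspace ?P = P"
      using P by (simp add: closedin_subset inf.absorb2)
    have cP: "compact_space ?P"
      using cpt P closedin_compact_space compact_space_subtopology by blast
    have HP: "Hausdorff_space ?P"
      using H by (rule Hausdorff_space_subtopology)
    have "P \<in> \<E> P A"
      unfolding \<E>_def using closedin_topspace[of ?P] openin_topspace[of ?P]
      by (simp add: top del: topspace_subtopology)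
    then have "x \<in> P"
      using x by auto
    have "\<not> separated_between ?P (A \<inter> P) {x}"
    proof
      assume "separated_between ?P (A \<inter> P) {x}"
      then obtain E where "closedin ?P E" "openin ?P E" "A \<inter> P \<subseteq> E" "x \<notin> E"
        unfolding separated_between by blast
      then show False
        using x unfolding \<E>_def by blast
    qed
    moreover have "compactin ?P (A \<inter> P)"
      using cpt P A by (auto simp: compactin_subtopology intro: closedin_compact_space)
    ultimately obtain a where a: "a \<in> A \<inter> P" "\<not> separated_between ?P {a} {x}"
      using separated_between_pointwise_left[of ?P "A \<inter> P" "{x}"] \<open>x \<in> P\<close> top by auto
    then have "quasi_component_of ?P a x"
      using \<open>x \<in> P\<close> top separated_between_singletons by fastforce
    then have ax: "connected_component_of ?P a x"
      using quasi_eq_connected_component_of[of ?P a] cP HP by auto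
    let ?C = "connected_component_of_set ?P a"
    have "?C \<subseteq> P"
      using connected_component_of_subset_topspace[of ?P a] top by simp
    have con: "connectedin X ?C"
      using connectedin_connected_component_of[of ?P a] by (simp add: connectedin_subtopology)
    have "closedin X ?C"
      using closedin_connected_component_of[of ?P a] P closedin_trans_full by blast
    then have "compactin X ?C"
      using cpt closedin_compact_space by blast
    moreover have "a \<in> ?C"
      using a top connected_component_of_refl[of ?P a] by auto
    ultimately have "subcontinuum X ?C"
      using con H unfolding subcontinuum_def continuum_def compactin_subspace connectedin_def
      by (auto intro: Hausdorff_space_subtopology)
    then show ?thesis
      using ax a \<open>a \<in> ?C\<close> \<open>?C \<subseteq> P\<close> by blast
  qed
  have "\<Inter>(\<E> P A) \<inter> \<Inter>(\<E> Q B) = {}"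
  proof (rule ccontr)
    assume "\<Inter>(\<E> P A) \<inter> \<Inter>(\<E> Q B) \<noteq> {}"
    then obtain x where "x \<in> \<Inter>(\<E> P A)" "x \<in> \<Inter>(\<E> Q B)"
      unfolding ex_in_conv[symmetric] Int_iff by (elim exE conjE)
    obtain C where "subcontinuum X C" "x \<in> C" "C \<subseteq> P" "C \<inter> A \<noteq> {}"
      using component[OF PQ(1) AB(1) \<open>x \<in> \<Inter>(\<E> P A)\<close>] by blast
    moreover obtain D where "subcontinuum X D" "x \<in> D" "D \<subseteq> Q" "D \<inter> B \<noteq> {}"
      using component[OF PQ(2) AB(2) \<open>x \<in> \<Inter>(\<E> Q B)\<close>] by blast
    ultimately have "C \<subseteq> D \<or> D \<subseteq> C"
      using hi unfolding hereditarily_indecomposable_def by blast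
    then show False
      using \<open>C \<subseteq> P\<close> \<open>D \<subseteq> Q\<close> \<open>C \<inter> A \<noteq> {}\<close> \<open>D \<inter> B \<noteq> {}\<close> disj by blast
  qed
  then have "\<Inter>(\<E> P A \<union> \<E> Q B) = {}"
    by (simp only: Inter_Un_distrib)
  moreover have "\<forall>C \<in> \<E> P A \<union> \<E> Q B. closedin X C"
    using PQ by (auto simp: \<E>_def intro: closedin_trans_full)
  \<comment> \<open>Compactness leaves finitely many clopen sets with empty intersection;
    intersecting those of each family separately gives \<open>E\<close> and
    \<open>G\<close>.\<close>
  ultimately obtain \<F> where \<F>: "finite \<F>" "\<F> \<subseteq> \<E> P A \<union> \<E> Q B" "\<Inter>\<F> = {}"
    using cpt unfolding compact_space_fip by metis
  let ?E = "\<Inter>(\<F> \<inter> \<E> P A) \<inter> topspace (subtopology X P)"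
  let ?G = "\<Inter>(\<F> \<inter> \<E> Q B) \<inter> topspace (subtopology X Q)"
  have "?E \<in> \<E> P A" "?G \<in> \<E> Q B"
    using \<F> AB by (auto intro!: Int simp del: topspace_subtopology)
  moreover have "?E \<inter> ?G \<subseteq> \<Inter>\<F>"
    using \<F>(2) by auto
  then have "?E \<inter> ?G = {}"
    using \<F>(3) by simp
  ultimately show thesis
    unfolding \<E>_def mem_Collect_eq by (elim conjE) (rule that)
qed

text \<open>With \<open>P\<close> and \<open>Q\<close> the complements of \<open>V\<close> and
  \<open>U\<close>, the overlap conditions make \<open>F\<^sub>A \<inter> P\<close> clopen in
  \<open>P\<close>, \<open>F\<^sub>B \<inter> Q\<close> clopen in \<open>Q\<close>, and these two
  sets disjoint. The proof builds the cover from clopen sets \<open>E\<close> and \<open>G\<close>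
  prescribed for these traces.\<close>

lemma hereditarily_indecomposable_imp_crooked_space:
  assumes cpt: "compact_space X" and H: "Hausdorff_space X" and hi: "hereditarily_indecomposable X"
  shows "crooked_space X"
  unfolding crooked_space_def
proof (intro allI impI)
  fix A B U V
  assume "admissible X A B U V"
  then have AB: "closedin X A" "closedin X B" "openin X U" "openin X V" "A \<subseteq> U" "B \<subseteq> V"
    by (auto simp: admissible_def)
  define P Q where "P = topspace X - V" and "Q = topspace X - U"
  have PQ: "closedin X P" "closedin X Q"
    using AB by (auto simp: P_def Q_def)
  have disj: "A \<inter> Q = {}" "B \<inter> P = {}"
    using AB by (auto simp: P_def Q_def)
  obtain E G where E: "closedin (subtopology X P) E" "openin (subtopology X P) E" "A \<inter> P \<subseteq> E"
    and G: "closedin (subtopology X Q) G" "openin (subtopology X Q) G" "B \<inter> Q \<subseteq> G"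
    and EG: "E \<inter> G = {}"
    using separated_clopen_sets[OF cpt H hi PQ AB(1,2) disj] by metis
  have sub: "E \<subseteq> P" "G \<subseteq> Q"
    using E(1) G(1) closedin_subset by fastforce+
  have cl: "closedin X E" "closedin X G"
    using E(1) G(1) PQ closedin_trans_full by blast+
  have "closedin (subtopology X P) (P - E)" "closedin (subtopology X Q) (Q - G)"
    using E(2) G(2) PQ closedin_subset[OF PQ(1)] closedin_subset[OF PQ(2)]
    by (auto simp: openin_closedin_eq inf.absorb2)
  then have cl': "closedin X (P - E)" "closedin X (Q - G)"
    using PQ closedin_trans_full by blast+
  have normal: "normal_space X"
    using cpt H compact_Hausdorff_or_regular_imp_normal_space by blast
  \<comment> \<open>The closure of \<open>V\<^sub>A\<close> will meet \<open>P\<close> only in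
    \<open>E\<close>. Since \<open>E\<close> lies in \<open>V\<^sub>A\<close> and the closure of
    \<open>V\<^sub>B\<close> avoids \<open>E\<close>, the overlaps of the first closure with the
    remainder and with the second closure lie in \<open>V\<close>. The other side is
    symmetric.\<close>
  have "openin X (topspace X - ((P - E) \<union> G))" "openin X (topspace X - ((Q - G) \<union> E))"
    using cl cl' by auto
  moreover have "A \<union> E \<subseteq> topspace X - ((P - E) \<union> G)" "B \<union> G \<subseteq> topspace X - ((Q - G) \<union> E)"
    using AB sub E G EG disj closedin_subset[OF cl(1)] closedin_subset[OF cl(2)]
      closedin_subset[OF AB(1)] closedin_subset[OF AB(2)] by blast+
  moreover have "closedin X (A \<union> E)" "closedin X (B \<union> G)"
    using AB cl by auto
  ultimately obtain V\<^sub>A V\<^sub>B where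
    VA: "openin X V\<^sub>A" "A \<union> E \<subseteq> V\<^sub>A" "X closure_of V\<^sub>A \<subseteq> topspace X - ((P - E) \<union> G)" and
    VB: "openin X V\<^sub>B" "B \<union> G \<subseteq> V\<^sub>B" "X closure_of V\<^sub>B \<subseteq> topspace X - ((Q - G) \<union> E)"
    using normal unfolding normal_space_alt by metis
  have clo: "V\<^sub>A \<subseteq> X closure_of V\<^sub>A" "V\<^sub>B \<subseteq> X closure_of V\<^sub>B"
    using VA VB by (auto intro!: closure_of_subset openin_subset)
  show "crooked_at X A B U V"
    unfolding crooked_at_def
  proof (intro exI conjI)
    show "closedin X (X closure_of V\<^sub>A)" "closedin X (topspace X - (V\<^sub>A \<union> V\<^sub>B))"
      "closedin X (X closure_of V\<^sub>B)"
      using VA VB by auto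
    show "topspace X = X closure_of V\<^sub>A \<union> (topspace X - (V\<^sub>A \<union> V\<^sub>B)) \<union> X closure_of V\<^sub>B"
      using clo closure_of_subset_topspace[of X] by blast
    show "A \<subseteq> X closure_of V\<^sub>A" "B \<subseteq> X closure_of V\<^sub>B"
      using VA VB clo by auto
    show "X closure_of V\<^sub>A \<inter> (topspace X - (V\<^sub>A \<union> V\<^sub>B)) \<subseteq> V"
      "X closure_of V\<^sub>B \<inter> (topspace X - (V\<^sub>A \<union> V\<^sub>B)) \<subseteq> U"
      "X closure_of V\<^sub>A \<inter> X closure_of V\<^sub>B \<subseteq> U \<inter> V"
      using VA VB closure_of_subset_topspace[of X] unfolding P_def Q_def by blast+
  qed
qed

subsection \<open>Metric neighbourhoods and normality\<close>

lemma set_nbhd_iff: "y \<in> set_nbhd Y \<epsilon> A \<longleftrightarrow> y \<in> mspace Y \<and> (\<exists>a\<in>A. mdist Y y a < \<epsilon>)"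
proof -
  have "bdd_below ((\<lambda>a. mdist Y y a) ` A)"
    by (rule bdd_belowI[of _ 0]) auto
  then have "A \<noteq> {} \<and> (INF a\<in>A. mdist Y y a) < \<epsilon> \<longleftrightarrow> (\<exists>a\<in>A. mdist Y y a < \<epsilon>)"
    by (cases "A = {}") (simp_all add: cINF_less_iff)
  then show ?thesis
    by (simp add: set_nbhd_def)
qed

lemma openin_set_nbhd:
  assumes "A \<subseteq> mspace Y"
  shows "openin (mtopology_of Y) (set_nbhd Y \<epsilon> A)"
proof -
  have "set_nbhd Y \<epsilon> A = (\<Union>a\<in>A. mball_of Y a \<epsilon>)"
    using assms by (fastforce simp: set_nbhd_iff mdist_commute)
  then show ?thesis
    by (auto simp: mtopology_of_def mball_of_def intro!: Metric_space.openin_mball)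
qed

lemma subset_set_nbhd: "A \<subseteq> mspace Y \<Longrightarrow> \<epsilon> > 0 \<Longrightarrow> A \<subseteq> set_nbhd Y \<epsilon> A"
  by (rule subsetI) (metis mdist_zero set_nbhd_iff subsetD)

lemma admissible_set_nbhd:
  assumes "closedin (mtopology_of Y) A" "closedin (mtopology_of Y) B" "\<epsilon> > 0"
  shows "admissible (mtopology_of Y) A B (set_nbhd Y \<epsilon> A) (set_nbhd Y \<epsilon> B)"
  using assms closedin_subset[OF assms(1)] closedin_subset[OF assms(2)]
  by (auto simp: admissible_def intro: openin_set_nbhd dest: subset_set_nbhd)

lemma set_nbhd_mono: "\<epsilon> \<le> \<delta> \<Longrightarrow> set_nbhd Y \<epsilon> A \<subseteq> set_nbhd Y \<delta> A"
  by (force simp: set_nbhd_iff)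

text \<open>A Lebesgue number of the one-element cover \<open>{U}\<close> of the compact set
  \<open>A\<close> serves as \<epsilon>.\<close>

lemma set_nbhd_subset_open:
  assumes "compactin (mtopology_of Y) A" "openin (mtopology_of Y) U" "A \<subseteq> U"
  obtains \<epsilon> where "\<epsilon> > 0" "set_nbhd Y \<epsilon> A \<subseteq> U"
proof -
  interpret Metric_space "mspace Y" "mdist Y" by blast
  have AY: "A \<subseteq> mspace Y"
    using compactin_subset_topspace[OF assms(1)] by simp
  obtain \<epsilon> where e: "\<epsilon> > 0" "\<And>x. x \<in> A \<Longrightarrow> \<exists>S \<in> {U}. mball x \<epsilon> \<subseteq> S"
    using lebesgue_number[of A "{U}"] assms by (auto simp: mtopology_of_def)
  have "set_nbhd Y \<epsilon> A \<subseteq> U"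
    using e(2) AY by (fastforce simp: set_nbhd_iff commute)
  then show ?thesis
    using that e(1) by blast
qed

text \<open>Unions of closed balls of radius \<epsilon>/2 around the points of a finite net form a
  finite family. For a given \<open>A\<close>, the union over the centres near \<open>A\<close> is
  the approximation.\<close>

lemma finite_closed_approximations:
  assumes cpt: "compact_space (mtopology_of Y)" and e: "\<epsilon> > 0"
  obtains \<C> where "finite \<C>" "\<And>C. C \<in> \<C> \<Longrightarrow> closedin (mtopology_of Y) C"
    "\<And>A. A \<subseteq> mspace Y \<Longrightarrow> \<exists>C \<in> \<C>. A \<subseteq> C \<and> C \<subseteq> set_nbhd Y \<epsilon> A"
proof -
  interpret Metric_space "mspace Y" "mdist Y" by blast
  have "mtotally_bounded (mspace Y)"
    using cpt compact_space_eq_mcomplete_mtotally_bounded by (simp add: mtopology_of_def)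
  then obtain K where K: "finite K" "K \<subseteq> mspace Y" "mspace Y \<subseteq> (\<Union>x\<in>K. mball x (\<epsilon>/2))"
    using e unfolding mtotally_bounded_def by (metis half_gt_zero)
  let ?\<C> = "(\<lambda>S. \<Union>x\<in>S. mcball x (\<epsilon>/2)) ` Pow K"
  show ?thesis
  proof (rule that[of ?\<C>])
    show "finite ?\<C>"
      using K by auto
    show "closedin (mtopology_of Y) C" if "C \<in> ?\<C>" for C
      using that K(1) by (auto simp: mtopology_of_def intro!: closedin_Union dest: finite_subset)
    fix A assume A: "A \<subseteq> mspace Y"
    \<comment> \<open>Centres are selected by open balls, so that the two distances add up to
      strictly less than \<epsilon> although the union is made of closed balls.\<close>
    let ?S = "{x \<in> K. mball x (\<epsilon>/2) \<inter> A \<noteq> {}}"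
    have "A \<subseteq> (\<Union>x\<in>?S. mcball x (\<epsilon>/2))"
    proof
      fix a assume "a \<in> A"
      then obtain x where "x \<in> K" "a \<in> mball x (\<epsilon>/2)"
        using A K(3) by blast
      then show "a \<in> (\<Union>x\<in>?S. mcball x (\<epsilon>/2))"
        using \<open>a \<in> A\<close> mball_subset_mcball by blast
    qed
    moreover have "(\<Union>x\<in>?S. mcball x (\<epsilon>/2)) \<subseteq> set_nbhd Y \<epsilon> A"
    proof
      fix y assume "y \<in> (\<Union>x\<in>?S. mcball x (\<epsilon>/2))"
      then obtain x z where "y \<in> mcball x (\<epsilon>/2)" "z \<in> mball x (\<epsilon>/2)" "z \<in> A"
        by blast
      then have "mdist Y y z < \<epsilon>" "y \<in> mspace Y"
        using triangle[of y x z] by (auto simp: commute)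
      then show "y \<in> set_nbhd Y \<epsilon> A"
        using \<open>z \<in> A\<close> by (auto simp: set_nbhd_iff)
    qed
    moreover have "(\<Union>x\<in>?S. mcball x (\<epsilon>/2)) \<in> ?\<C>"
      by (rule imageI) simp
    ultimately show "\<exists>C \<in> ?\<C>. A \<subseteq> C \<and> C \<subseteq> set_nbhd Y \<epsilon> A"
      by (intro bexI conjI)
  qed
qed

lemma set_nbhd_set_nbhd:
  assumes "A \<subseteq> mspace Y" "C \<subseteq> set_nbhd Y \<delta> A"
  shows "set_nbhd Y \<epsilon> C \<subseteq> set_nbhd Y (\<epsilon> + \<delta>) A"
proof
  fix y assume "y \<in> set_nbhd Y \<epsilon> C"
  then obtain c where c: "y \<in> mspace Y" "c \<in> C" "mdist Y y c < \<epsilon>"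
    by (auto simp: set_nbhd_iff)
  then obtain a where a: "c \<in> mspace Y" "a \<in> A" "mdist Y c a < \<delta>"
    using assms(2) by (auto simp: set_nbhd_iff subset_iff)
  have "mdist Y y a < \<epsilon> + \<delta>"
    using mdist_triangle[of y Y c a] a c assms(1) by auto
  then show "y \<in> set_nbhd Y (\<epsilon> + \<delta>) A"
    using a c by (auto simp: set_nbhd_iff)
qed

text \<open>The sets \<open>Q - U\<close> and \<open>R - V\<close> are closed and miss
  \<open>P\<close>, so normality keeps the closure of some neighbourhood of \<open>P\<close> away
  from them. Two constraints are handled at once because each member of a three-set cover overlaps
  two others.\<close>

lemma normal_space_enlarge:
  assumes "normal_space X" "closedin X P" "closedin X Q" "closedin X R" "openin X U" "openin X V"
    and "P \<inter> Q \<subseteq> U" "P \<inter> R \<subseteq> V"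
  obtains W where "openin X W" "P \<subseteq> W" "X closure_of W \<inter> Q \<subseteq> U" "X closure_of W \<inter> R \<subseteq> V"
proof -
  have "openin X (topspace X - ((Q - U) \<union> (R - V)))"
    using assms by auto
  moreover have "P \<subseteq> topspace X - ((Q - U) \<union> (R - V))"
    using assms closedin_subset[OF assms(2)] by blast
  ultimately obtain W where "openin X W" "P \<subseteq> W" "X closure_of W \<subseteq> topspace X - ((Q - U) \<union> (R - V))"
    using assms(1,2) unfolding normal_space_alt by metis
  with that show thesis
    by blast
qed

subsection \<open>Inverse sequences of metric compacta\<close>

lemma uniform_stage:
  fixes Q :: "'p \<Rightarrow> nat \<Rightarrow> bool"
  assumes "finite S" and ex: "\<And>p. p \<in> S \<Longrightarrow> \<exists>m\<ge>n. Q p m"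
    and mono: "\<And>p m k. p \<in> S \<Longrightarrow> n \<le> m \<Longrightarrow> m \<le> k \<Longrightarrow> Q p m \<Longrightarrow> Q p k"
  shows "\<exists>m\<ge>n. \<forall>p\<in>S. Q p m"
proof -
  obtain g where g: "\<And>p. p \<in> S \<Longrightarrow> n \<le> g p \<and> Q p (g p)"
    using ex by metis
  \<comment> \<open>Including \<open>n\<close> keeps the bound at least \<open>n\<close> even when
    \<open>S\<close> is empty.\<close>
  obtain m where m: "\<And>k. k \<in> insert n (g ` S) \<Longrightarrow> k \<le> m"
    using finite_nat_set_iff_bounded_le[of "insert n (g ` S)"] \<open>finite S\<close> by auto
  have "Q p m" if "p \<in> S" for p
    using mono[OF that, of "g p" m] g[OF that] m[of "g p"] that by blast
  then show ?thesis
    using m[of n] by blast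
qed

locale compact_inverse_sequence =
  fixes X :: "nat \<Rightarrow> 'a metric" and f :: "nat \<Rightarrow> 'a \<Rightarrow> 'a"
  assumes inverse_sequence: "inverse_sequence X f"
begin

abbreviation T :: "nat \<Rightarrow> 'a topology" where "T n \<equiv> mtopology_of (X n)"
abbreviation L :: "(nat \<Rightarrow> 'a) topology" where "L \<equiv> inverse_limit X f"
abbreviation b :: "nat \<Rightarrow> nat \<Rightarrow> 'a \<Rightarrow> 'a" where "b n m \<equiv> bonding_map f n m"

section \<open>The spaces and bonding maps of the sequence\<close>

lemma compact_T: "compact_space (T n)"
  using inverse_sequence by (simp add: inverse_sequence_def)

lemma Hausdorff_T: "Hausdorff_space (T n)"
  by (simp add: mtopology_of_def Metric_space.Hausdorff_space_mtopology)

lemma normal_T: "normal_space (T n)"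
  using compact_Hausdorff_or_regular_imp_normal_space[OF compact_T] Hausdorff_T by blast

lemma continuous_f: "continuous_map (T (Suc n)) (T n) (f n)"
  using inverse_sequence by (simp add: inverse_sequence_def)

lemma bonding_refl [simp]: "b n n = id"
  by (simp add: bonding_map_def)

lemma bonding_Suc: "n \<le> m \<Longrightarrow> b n (Suc m) = b n m \<circ> f m"
proof -
  \<comment> \<open>The last bonding map takes the place of \<open>id\<close> in the fold and has to
    be pulled out on the right.\<close>
  have foldr_comp: "foldr (\<circ>) gs g = foldr (\<circ>) gs id \<circ> g" for gs and g :: "'a \<Rightarrow> 'a"
    by (induction gs) (auto simp: o_assoc)
  show "n \<le> m \<Longrightarrow> b n (Suc m) = b n m \<circ> f m"
    using foldr_comp[of "map f [n..<m]" "f m"] by (simp add: bonding_map_def)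
qed

lemma bonding_trans:
  assumes "n \<le> m" "m \<le> k"
  shows "b n k y = b n m (b m k y)"
  using assms(2)
  by (induction k arbitrary: y rule: dec_induct) (use assms(1) in \<open>simp_all add: bonding_Suc\<close>)

lemma bonding_step: "i < k \<Longrightarrow> b i k y = f i (b (Suc i) k y)"
  using bonding_trans[of i "Suc i" k y] by (simp add: bonding_Suc)

lemma continuous_bonding: "n \<le> m \<Longrightarrow> continuous_map (T m) (T n) (b n m)"
proof (induction m rule: dec_induct)
  case base
  show ?case by simp
next
  case (step m)
  show ?case
    unfolding bonding_Suc[OF step.hyps(1)] by (rule continuous_map_compose[OF continuous_f step.IH])
qed

lemma bonding_in: "n \<le> m \<Longrightarrow> y \<in> mspace (X m) \<Longrightarrow> b n m y \<in> mspace (X n)"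
  using continuous_bonding[of n m] by (auto simp: continuous_map_def)

section \<open>Threads and compactness of the limit\<close>

lemma topspace_L: "topspace L = {x. (\<forall>n. x n \<in> mspace (X n)) \<and> (\<forall>n. f n (x (Suc n)) = x n)}"
  by (auto simp: inverse_limit_def)

lemma thread_in: "x \<in> topspace L \<Longrightarrow> x n \<in> mspace (X n)"
  by (simp add: topspace_L)

lemma bonding_thread: "x \<in> topspace L \<Longrightarrow> n \<le> m \<Longrightarrow> b n m (x m) = x n"
proof -
  assume x: "x \<in> topspace L"
  show "n \<le> m \<Longrightarrow> b n m (x m) = x n"
    by (induction m rule: dec_induct) (use x in \<open>auto simp: bonding_Suc topspace_L\<close>)
qed

lemma compact_product: "compact_space (product_topology T UNIV)"
  by (simp add: compact_space_product_topology compact_T)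

lemma continuous_coordinate: "continuous_map (product_topology T UNIV) (T i) (\<lambda>x. x i)"
  by (rule continuous_map_product_projection) simp

lemma continuous_projection: "continuous_map L (T n) (\<lambda>x. x n)"
  unfolding inverse_limit_def
  by (intro continuous_map_from_subtopology continuous_coordinate)

text \<open>The equalizer of two continuous maps into a Hausdorff space is closed.\<close>

lemma closedin_coherent:
  "closedin (product_topology T UNIV) {x \<in> topspace (product_topology T UNIV). f i (x (Suc i)) = x i}"
  using closedin_continuous_maps_eq[OF Hausdorff_T
      continuous_map_compose[OF continuous_coordinate continuous_f] continuous_coordinate]
  by (simp only: comp_def)

lemma compact_L: "compact_space L"
proof -
  have "closedin (product_topology T UNIV)
      (\<Inter>i. {x \<in> topspace (product_topology T UNIV). f i (x (Suc i)) = x i})"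
    by (rule closedin_Inter) (use closedin_coherent in auto)
  moreover have "(\<Inter>i. {x \<in> topspace (product_topology T UNIV). f i (x (Suc i)) = x i}) = topspace L"
    by (auto simp: topspace_L)
  ultimately have "compactin (product_topology T UNIV) (topspace L)"
    using closedin_compact_space[OF compact_product] by simp
  \<comment> \<open>The coherence set in the definition of the limit is not confined to the carrier
    of the product, so it is first cut down to the threads.\<close>
  moreover have "L = subtopology (product_topology T UNIV) (topspace L)"
    unfolding inverse_limit_def by (metis subtopology_restrict topspace_subtopology)
  ultimately show ?thesis
    by (metis compact_space_subtopology)
qed

lemma Hausdorff_L: "Hausdorff_space L"
  unfolding inverse_limit_def
  by (intro Hausdorff_space_subtopology) (simp add: Hausdorff_space_product_topology Hausdorff_T)

section \<open>Open and closed sets of the limit seen at finite stages\<close>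

text \<open>A basic box restricts only finitely many coordinates, and on threads all coordinates up
  to \<open>m\<close> are determined by the \<open>m\<close>-th.\<close>

lemma basic_open_set:
  assumes "openin L U" "x \<in> U"
  obtains m W where "openin (T m) W" "x m \<in> W" "{x \<in> topspace L. x m \<in> W} \<subseteq> U"
proof -
  obtain V where V: "openin (product_topology T UNIV) V"
    and U: "U = V \<inter> {x. \<forall>n. f n (x (Suc n)) = x n}"
    using assms(1) unfolding inverse_limit_def openin_subtopology by blast
  obtain D where D: "finite {i \<in> UNIV. D i \<noteq> topspace (T i)}" "\<forall>i\<in>UNIV. openin (T i) (D i)"
    "x \<in> Pi\<^sub>E UNIV D" "Pi\<^sub>E UNIV D \<subseteq> V"
    using V U assms(2) unfolding openin_product_topology_alt by blast
  obtain m where m: "\<And>i. D i \<noteq> topspace (T i) \<Longrightarrow> i \<le> m"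
    using D(1) finite_nat_set_iff_bounded_le by auto
  let ?W = "\<Inter>i\<in>{..m}. {y \<in> topspace (T m). b i m y \<in> D i}"
  have x: "x \<in> topspace L"
    using assms openin_subset by blast
  have "openin (T m) ?W"
  proof (rule openin_Inter)
    show "openin (T m) S" if "S \<in> (\<lambda>i. {y \<in> topspace (T m). b i m y \<in> D i}) ` {..m}" for S
      using that D(2) continuous_bonding
      by (auto intro!: openin_continuous_map_preimage simp del: topspace_mtopology_of)
  qed auto
  moreover have "x m \<in> ?W"
    using D(3) x bonding_thread[OF x] by (auto simp: thread_in PiE_iff)
  moreover have "{z \<in> topspace L. z m \<in> ?W} \<subseteq> U"
  proof clarify
    fix z assume z: "z \<in> topspace L" "z m \<in> ?W"
    have "z i \<in> D i" for i
    proof (cases "i \<le> m")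
      case True
      then have "b i m (z m) \<in> D i"
        using z(2) by blast
      then show ?thesis
        using bonding_thread[OF z(1) True] by simp
    next
      case False
      then show ?thesis
        using m[of i] thread_in[OF z(1), of i] by auto
    qed
    then have "z \<in> V"
      using D(4) by (auto simp: PiE_iff)
    then show "z \<in> U"
      using z(1) U by (simp add: topspace_L)
  qed
  ultimately show thesis
    by (rule that)
qed

text \<open>Preimages of open sets under the projections form a basis that is closed under finite unions.\<close>

lemma closed_in_open_factor:
  assumes A: "closedin L A" and U: "openin L U" and AU: "A \<subseteq> U"
  obtains N where
    "\<And>m. N \<le> m \<Longrightarrow> \<exists>W. openin (T m) W \<and> (\<forall>x\<in>A. x m \<in> W) \<and> (\<forall>x\<in>topspace L. x m \<in> W \<longrightarrow> x \<in> U)"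
proof -
  let ?p = "\<lambda>m W. {x \<in> topspace L. x m \<in> W}"
  let ?\<G> = "{S. S \<subseteq> U \<and> (\<exists>m W. openin (T m) W \<and> S = ?p m W)}"
  have "compactin L A"
    using compact_L A closedin_compact_space by blast
  moreover have "\<forall>S\<in>?\<G>. openin L S"
    by (auto intro!: openin_continuous_map_preimage[OF continuous_projection])
  moreover have "A \<subseteq> \<Union>?\<G>"
  proof
    fix x assume x: "x \<in> A"
    then obtain m W where "openin (T m) W" "x m \<in> W" "?p m W \<subseteq> U"
      using basic_open_set[OF U, of x] AU by blast
    moreover have "x \<in> topspace L"
      using x A closedin_subset by blast
    ultimately show "x \<in> \<Union>?\<G>"
      by (intro UnionI[of "?p m W"]) auto
  qed
  ultimately obtain \<F> where \<F>: "finite \<F>" "\<F> \<subseteq> ?\<G>" "A \<subseteq> \<Union>\<F>"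
    unfolding compactin_def by meson
  \<comment> \<open>Asking for all late stages, not just one, lets later arguments use several such
    sets at a common stage.\<close>
  have "\<exists>N. \<forall>m\<ge>N. \<exists>W. openin (T m) W \<and> \<Union>\<F> = ?p m W"
    using \<F>(1,2)
  proof (induction \<F> rule: finite_induct)
    case empty
    show ?case
      by (rule exI[of _ 0]) (auto intro!: exI[of _ "{}"])
  next
    case (insert S \<F>)
    have "\<exists>N. \<forall>m\<ge>N. \<exists>W. openin (T m) W \<and> \<Union>\<F> = ?p m W"
      using insert.IH insert.prems by simp
    then obtain N where N: "\<forall>m\<ge>N. \<exists>W. openin (T m) W \<and> \<Union>\<F> = ?p m W" ..
    have "\<exists>k V. openin (T k) V \<and> S = ?p k V"
      using insert.prems by simp
    then obtain k V where V: "openin (T k) V" "S = ?p k V"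
      by (elim exE conjE)
    have "\<exists>W. openin (T m) W \<and> \<Union>(insert S \<F>) = ?p m W" if "m \<ge> max N k" for m
    proof -
      have "N \<le> m"
        using that by simp
      then have "\<exists>W. openin (T m) W \<and> \<Union>\<F> = ?p m W"
        by (rule N[rule_format])
      then obtain W where W: "openin (T m) W" "\<Union>\<F> = ?p m W"
        by (elim exE conjE)
      let ?V = "{y \<in> topspace (T m). b k m y \<in> V}"
      have "openin (T m) ?V"
        using that V(1) by (intro openin_continuous_map_preimage[OF continuous_bonding]) auto
      moreover have "S = ?p m ?V"
        using V(2) that by (auto simp: bonding_thread thread_in)
      ultimately have "openin (T m) (?V \<union> W)" "\<Union>(insert S \<F>) = ?p m (?V \<union> W)"
        using W by auto
      then show ?thesis
        by (intro exI conjI)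
    qed
    then show ?case
      by (intro exI[of _ "max N k"] allI impI)
  qed
  then obtain N where N: "\<forall>m\<ge>N. \<exists>W. openin (T m) W \<and> \<Union>\<F> = ?p m W" ..
  show thesis
  proof (rule that)
    fix m assume "N \<le> m"
    then have "\<exists>W. openin (T m) W \<and> \<Union>\<F> = ?p m W"
      by (rule N[rule_format])
    then obtain W where W: "openin (T m) W" "\<Union>\<F> = ?p m W"
      by (elim exE conjE)
    have "\<Union>\<F> \<subseteq> U"
      using \<F>(2) by blast
    then have "A \<subseteq> ?p m W" "?p m W \<subseteq> U"
      using W(2) \<F>(3) by simp_all
    then show "\<exists>W. openin (T m) W \<and> (\<forall>x\<in>A. x m \<in> W) \<and> (\<forall>x\<in>topspace L. x m \<in> W \<longrightarrow> x \<in> U)"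
      using W(1) by (intro exI[of _ W]) auto
  qed
qed

text \<open>Otherwise the points of the product that have \<open>m\<close>-th coordinate in
  \<open>K\<close> and satisfy the first \<open>k\<close> coherence equations form a decreasing
  sequence of nonempty closed sets. A point common to all of them is a thread through
  \<open>K\<close>.\<close>

lemma empty_preimage_at_finite_stage:
  assumes K: "closedin (T m) K" and empty: "\<And>x. x \<in> topspace L \<Longrightarrow> x m \<notin> K"
  shows "\<exists>k\<ge>m. \<forall>y\<in>mspace (X k). b m k y \<notin> K"
proof (rule ccontr)
  assume "\<not> ?thesis"
  then have ne: "\<exists>y\<in>mspace (X k). b m k y \<in> K" if "k \<ge> m" for k
    using that by blast
  let ?P = "product_topology T UNIV"
  let ?C = "\<lambda>k. {x \<in> topspace ?P. x m \<in> K} \<inter> (\<Inter>i\<in>{i. i < k}. {x \<in> topspace ?P. f i (x (Suc i)) = x i})"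
  have nonempty: "mspace (X i) \<noteq> {}" for i
    using ne[of "max i m"] bonding_in[of i "max i m"] by fastforce
  have "(\<Inter>k. ?C k) \<noteq> {}"
  proof (rule compact_space_imp_nest[OF compact_product])
    show "closedin ?P (?C k)" for k
    \<comment> \<open>For \<open>k = 0\<close> the inner intersection is empty-indexed and equals
      \<open>UNIV\<close>, which need not be closed in the product.\<close>
    proof (cases "k = 0")
      case True
      then show ?thesis
        using closedin_continuous_map_preimage[OF continuous_coordinate K] by simp
    next
      case False
      then show ?thesis
        using closedin_continuous_map_preimage[OF continuous_coordinate K]
        by (intro closedin_Int closedin_INT closedin_coherent) auto
    qed
    show "decseq ?C"
      by (auto simp: decseq_def)
    show "?C k \<noteq> {}" for k
    proof -
      obtain y where y: "y \<in> mspace (X (max k m))" "b m (max k m) y \<in> K"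
        using ne[of "max k m"] by auto
      have "\<forall>i. \<exists>y. y \<in> mspace (X i)"
        using nonempty by blast
      then obtain d where d: "\<And>i. d i \<in> mspace (X i)"
        by metis
      \<comment> \<open>Coordinates up to \<open>max k m\<close> are images of \<open>y\<close>; the
        later ones are arbitrary, since the equations with \<open>i < k\<close> involve only
        coordinates up to \<open>k\<close>.\<close>
      let ?x = "\<lambda>i. if i \<le> max k m then b i (max k m) y else d i"
      have "?x i \<in> mspace (X i)" for i
        using d bonding_in y by auto
      moreover have "?x m \<in> K"
        using y by simp
      moreover have "f i (?x (Suc i)) = ?x i" if "i < k" for i
        using that bonding_step[of i "max k m" y] by auto
      ultimately have "?x \<in> ?C k"
        by auto
      then show ?thesis
        by blast
    qed
  qed
  then obtain x where x: "\<And>k. x \<in> ?C k"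
    by blast
  have "x m \<in> K" "x \<in> topspace ?P"
    using x[of 0] by auto
  moreover have "f i (x (Suc i)) = x i" for i
    using x[of "Suc i"] by auto
  ultimately show False
    using empty[of x] by (auto simp: topspace_L PiE_iff)
qed

text \<open>The parts of \<open>F\<close> and \<open>H\<close> not lying over \<open>U\<close> are
  disjoint and closed, so at every late stage an open set contains the image of the first and misses
  that of the second.\<close>

lemma images_inter_subset:
  assumes F: "closedin L F" "closedin L H" and U: "openin (T n) U"
    and FH: "\<And>x. x \<in> F \<Longrightarrow> x \<in> H \<Longrightarrow> x n \<in> U"
  obtains N where "\<And>m x y. N \<le> m \<Longrightarrow> x \<in> F \<Longrightarrow> y \<in> H \<Longrightarrow> x m = y m \<Longrightarrow> x n \<in> U"
proof -
  let ?U = "{x \<in> topspace L. x n \<in> U}"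
  have U': "openin L ?U"
    using U by (rule openin_continuous_map_preimage[OF continuous_projection])
  have "closedin L (F - ?U)" "openin L (topspace L - (H - ?U))"
    using F U' by auto
  moreover have "F - ?U \<subseteq> topspace L - (H - ?U)"
    using F FH closedin_subset by fastforce
  ultimately obtain N where N: "\<And>m. N \<le> m \<Longrightarrow> \<exists>W. openin (T m) W \<and> (\<forall>x\<in>F - ?U. x m \<in> W)
      \<and> (\<forall>x\<in>topspace L. x m \<in> W \<longrightarrow> x \<in> topspace L - (H - ?U))"
    by (rule closed_in_open_factor) auto
  show thesis
  \<comment> \<open>Stages from \<open>n\<close> on are needed so that equal \<open>m\<close>-th
    coordinates force equal \<open>n\<close>-th coordinates.\<close>
  proof (rule that[of "max N n"])
    fix m x y assume m: "max N n \<le> m" and x: "x \<in> F" and y: "y \<in> H" and eq: "x m = y m"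
    have xy: "x \<in> topspace L" "y \<in> topspace L"
      using x y F closedin_subset by blast+
    have "x n = y n"
      using xy m eq bonding_thread[of x n m] bonding_thread[of y n m] by simp
    obtain W where W: "\<forall>x\<in>F - ?U. x m \<in> W" "\<forall>x\<in>topspace L. x m \<in> W \<longrightarrow> x \<in> topspace L - (H - ?U)"
      using N[of m] m by auto
    show "x n \<in> U"
    proof (rule ccontr)
      assume "x n \<notin> U"
      then have "x m \<in> W"
        using W(1) x by blast
      then have "y m \<in> W"
        by (simp only: eq)
      then have "y n \<in> U"
        using W(2) y xy by blast
      with \<open>x n = y n\<close> \<open>x n \<notin> U\<close> show False
        by simp
    qed
  qed
qed

section \<open>Descent of crookedness from the limit to a finite stage\<close>

text \<open>The images of \<open>F\<^sub>A\<close>, \<open>H\<close> and \<open>F\<^sub>B\<close> in a late space of the sequence still meet correctly, but they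
  cover only the image of the limit. Enlarging them to closed neighbourhoods leaves a closed set of bad points
  outside that image, which disappears at a later stage.\<close>

lemma crooked_at_finite_stage:
  assumes A: "closedin (T n) A" and B: "closedin (T n) B" and U: "openin (T n) U" and V: "openin (T n) V"
    and cr: "crooked_map_at L (limit_projection n) A B U V"
  shows "\<exists>m\<ge>n. crooked_map_at (T m) (b n m) A B U V"
proof -
  obtain F H G where c: "closedin L F" "closedin L H" "closedin L G"
    and cov: "topspace L = F \<union> H \<union> G"
    and s: "{x \<in> topspace L. x n \<in> A} \<subseteq> F" "{x \<in> topspace L. x n \<in> B} \<subseteq> G"
      "F \<inter> H \<subseteq> {x \<in> topspace L. x n \<in> V}" "G \<inter> H \<subseteq> {x \<in> topspace L. x n \<in> U}"
      "F \<inter> G \<subseteq> {x \<in> topspace L. x n \<in> U} \<inter> {x \<in> topspace L. x n \<in> V}"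
    using cr unfolding crooked_map_at_def crooked_at_def limit_projection_def by (elim exE conjE) (rule that)
  obtain N1 where N1: "\<And>m x y. N1 \<le> m \<Longrightarrow> x \<in> F \<Longrightarrow> y \<in> H \<Longrightarrow> x m = y m \<Longrightarrow> x n \<in> V"
    by (rule images_inter_subset[OF c(1) c(2) V]) (use s in auto)
  obtain N2 where N2: "\<And>m x y. N2 \<le> m \<Longrightarrow> x \<in> G \<Longrightarrow> y \<in> H \<Longrightarrow> x m = y m \<Longrightarrow> x n \<in> U"
    by (rule images_inter_subset[OF c(3) c(2) U]) (use s in auto)
  obtain N3 where N3: "\<And>m x y. N3 \<le> m \<Longrightarrow> x \<in> F \<Longrightarrow> y \<in> G \<Longrightarrow> x m = y m \<Longrightarrow> x n \<in> U \<inter> V"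
    by (rule images_inter_subset[OF c(1) c(3) openin_Int[OF U V]]) (use s in auto)
  define m where "m = Max {n, N1, N2, N3}"
  have m: "n \<le> m" "N1 \<le> m" "N2 \<le> m" "N3 \<le> m"
    by (auto simp: m_def)
  let ?q = "\<lambda>S. {y \<in> topspace (T m). b n m y \<in> S}"
  have closed_image: "closedin (T m) ((\<lambda>x. x m) ` S)" if "closedin L S" for S
    using image_compactin[OF closedin_compact_space[OF compact_L that] continuous_projection]
      compactin_imp_closedin[OF Hausdorff_T] by blast
  have op: "openin (T m) (?q U)" "openin (T m) (?q V)" "openin (T m) (?q (U \<inter> V))"
    using openin_continuous_map_preimage[OF continuous_bonding[OF m(1)]] U V by blast+
  have cl: "closedin (T m) (?q A)" "closedin (T m) (?q B)"
    using closedin_continuous_map_preimage[OF continuous_bonding[OF m(1)]] A B by blast+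
  have thread: "x m \<in> topspace (T m) \<and> b n m (x m) = x n" if "x \<in> F \<union> H \<union> G" for x
    using that cov m(1) by (simp add: thread_in bonding_thread)
  have i1: "(\<lambda>x. x m) ` F \<inter> (\<lambda>x. x m) ` H \<subseteq> ?q V"
  proof clarify
    fix x y assume "x \<in> F" "y \<in> H" "x m = y m"
    then show "x m \<in> topspace (T m) \<and> b n m (x m) \<in> V"
      using N1[OF m(2)] thread[of x] by auto
  qed
  have i2: "(\<lambda>x. x m) ` G \<inter> (\<lambda>x. x m) ` H \<subseteq> ?q U"
  proof clarify
    fix x y assume "x \<in> G" "y \<in> H" "x m = y m"
    then show "x m \<in> topspace (T m) \<and> b n m (x m) \<in> U"
      using N2[OF m(3)] thread[of x] by auto
  qed
  have i3: "(\<lambda>x. x m) ` F \<inter> (\<lambda>x. x m) ` G \<subseteq> ?q (U \<inter> V)"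
  proof clarify
    fix x y assume "x \<in> F" "y \<in> G" "x m = y m"
    then show "x m \<in> topspace (T m) \<and> b n m (x m) \<in> U \<inter> V"
      using N3[OF m(4)] thread[of x] by auto
  qed
  \<comment> \<open>The three images are enlarged one after another, each time against the closures
    already chosen and the images still to be enlarged.\<close>
  obtain W\<^sub>F where WF: "openin (T m) W\<^sub>F" "(\<lambda>x. x m) ` F \<subseteq> W\<^sub>F"
    "T m closure_of W\<^sub>F \<inter> (\<lambda>x. x m) ` H \<subseteq> ?q V" "T m closure_of W\<^sub>F \<inter> (\<lambda>x. x m) ` G \<subseteq> ?q (U \<inter> V)"
    by (rule normal_space_enlarge[OF normal_T closed_image[OF c(1)] closed_image[OF c(2)] closed_image[OF c(3)]
          op(2) op(3) i1 i3])
  have j: "(\<lambda>x. x m) ` H \<inter> T m closure_of W\<^sub>F \<subseteq> ?q V" "(\<lambda>x. x m) ` H \<inter> (\<lambda>x. x m) ` G \<subseteq> ?q U"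
    using WF(3) i2 by blast+
  obtain W\<^sub>H where WH: "openin (T m) W\<^sub>H" "(\<lambda>x. x m) ` H \<subseteq> W\<^sub>H"
    "T m closure_of W\<^sub>H \<inter> T m closure_of W\<^sub>F \<subseteq> ?q V" "T m closure_of W\<^sub>H \<inter> (\<lambda>x. x m) ` G \<subseteq> ?q U"
    by (rule normal_space_enlarge[OF normal_T closed_image[OF c(2)] closedin_closure_of closed_image[OF c(3)]
          op(2) op(1) j])
  have k: "(\<lambda>x. x m) ` G \<inter> T m closure_of W\<^sub>F \<subseteq> ?q (U \<inter> V)" "(\<lambda>x. x m) ` G \<inter> T m closure_of W\<^sub>H \<subseteq> ?q U"
    using WF(4) WH(4) by blast+
  obtain W\<^sub>G where WG: "openin (T m) W\<^sub>G" "(\<lambda>x. x m) ` G \<subseteq> W\<^sub>G"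
    "T m closure_of W\<^sub>G \<inter> T m closure_of W\<^sub>F \<subseteq> ?q (U \<inter> V)" "T m closure_of W\<^sub>G \<inter> T m closure_of W\<^sub>H \<subseteq> ?q U"
    by (rule normal_space_enlarge[OF normal_T closed_image[OF c(3)] closedin_closure_of closedin_closure_of
          op(3) op(1) k])
  \<comment> \<open>The bad points are those left uncovered and those over \<open>A\<close> or
    \<open>B\<close> outside the sets meant to contain them. Subtracting the open sets rather than
    their closures makes \<open>K\<close> closed.\<close>
  define K where "K = (topspace (T m) - (W\<^sub>F \<union> W\<^sub>H \<union> W\<^sub>G)) \<union> (?q A - W\<^sub>F) \<union> (?q B - W\<^sub>G)"
  have "closedin (T m) K"
    unfolding K_def
    by (intro closedin_Un closedin_diff openin_Un closedin_topspace cl WF(1) WH(1) WG(1))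
  moreover have "x m \<notin> K" if x: "x \<in> topspace L" for x
  proof -
    have "b n m (x m) = x n"
      using bonding_thread[OF x m(1)] .
    moreover have "x m \<in> W\<^sub>F \<union> W\<^sub>H \<union> W\<^sub>G"
      using x cov WF(2) WH(2) WG(2) by blast
    moreover have "x m \<in> W\<^sub>F" if "x n \<in> A"
      using that x s(1) WF(2) by blast
    moreover have "x m \<in> W\<^sub>G" if "x n \<in> B"
      using that x s(2) WG(2) by blast
    ultimately show ?thesis
      unfolding K_def by auto
  qed
  ultimately have "\<exists>k\<ge>m. \<forall>y\<in>mspace (X k). b m k y \<notin> K"
    by (rule empty_preimage_at_finite_stage)
  then obtain k where k: "m \<le> k" and avoid: "\<And>y. y \<in> mspace (X k) \<Longrightarrow> b m k y \<notin> K"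
    by blast
  let ?r = "\<lambda>S. {y \<in> topspace (T k). b m k y \<in> S}"
  have nk: "b n k y = b n m (b m k y)" for y
    using bonding_trans m(1) k by blast
  have sub: "W\<^sub>F \<subseteq> T m closure_of W\<^sub>F" "W\<^sub>H \<subseteq> T m closure_of W\<^sub>H" "W\<^sub>G \<subseteq> T m closure_of W\<^sub>G"
    by (rule closure_of_subset[OF openin_subset], fact)+
  have img: "b m k y \<in> topspace (T m)" if "y \<in> topspace (T k)" for y
    using bonding_in k that by simp
  have "crooked_map_at (T k) (b n k) A B U V"
    unfolding crooked_map_at_def crooked_at_def
  proof (intro exI conjI)
    show "closedin (T k) (?r (T m closure_of W\<^sub>F))" "closedin (T k) (?r (T m closure_of W\<^sub>H))"
      "closedin (T k) (?r (T m closure_of W\<^sub>G))"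
      by (rule closedin_continuous_map_preimage[OF continuous_bonding[OF k] closedin_closure_of])+
    show "topspace (T k) = ?r (T m closure_of W\<^sub>F) \<union> ?r (T m closure_of W\<^sub>H) \<union> ?r (T m closure_of W\<^sub>G)"
    proof -
      have "b m k y \<in> W\<^sub>F \<union> W\<^sub>H \<union> W\<^sub>G" if "y \<in> topspace (T k)" for y
        using avoid[of y] img[OF that] that unfolding K_def by auto
      then show ?thesis
        using sub by blast
    qed
    show "{y \<in> topspace (T k). b n k y \<in> A} \<subseteq> ?r (T m closure_of W\<^sub>F)"
    proof
      fix y assume "y \<in> {y \<in> topspace (T k). b n k y \<in> A}"
      then have y: "y \<in> topspace (T k)" "b n k y \<in> A"
        by blast+
      then have "b m k y \<in> W\<^sub>F"
        using avoid[of y] img[OF y(1)] nk unfolding K_def by auto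
      then show "y \<in> ?r (T m closure_of W\<^sub>F)"
        using y sub by blast
    qed
    show "{y \<in> topspace (T k). b n k y \<in> B} \<subseteq> ?r (T m closure_of W\<^sub>G)"
    proof
      fix y assume "y \<in> {y \<in> topspace (T k). b n k y \<in> B}"
      then have y: "y \<in> topspace (T k)" "b n k y \<in> B"
        by blast+
      then have "b m k y \<in> W\<^sub>G"
        using avoid[of y] img[OF y(1)] nk unfolding K_def by auto
      then show "y \<in> ?r (T m closure_of W\<^sub>G)"
        using y sub by blast
    qed
    show "?r (T m closure_of W\<^sub>F) \<inter> ?r (T m closure_of W\<^sub>H) \<subseteq> {y \<in> topspace (T k). b n k y \<in> V}"
      using WH(3) nk by auto
    show "?r (T m closure_of W\<^sub>G) \<inter> ?r (T m closure_of W\<^sub>H) \<subseteq> {y \<in> topspace (T k). b n k y \<in> U}"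
      using WG(4) nk by auto
    show "?r (T m closure_of W\<^sub>F) \<inter> ?r (T m closure_of W\<^sub>G)
        \<subseteq> {y \<in> topspace (T k). b n k y \<in> U} \<inter> {y \<in> topspace (T k). b n k y \<in> V}"
      using WG(3) nk by auto
  qed
  then show ?thesis
    using m(1) k le_trans by blast
qed

section \<open>The implications between the conditions\<close>

lemma crooked_space_imp_crooked_projection:
  assumes "crooked_space L"
  shows "crooked_map L (T n) (limit_projection n)"
  unfolding crooked_map_def crooked_map_at_def
proof (intro allI impI)
  fix A B U V
  assume "admissible (T n) A B U V"
  then have "admissible L {x \<in> topspace L. x n \<in> A} {x \<in> topspace L. x n \<in> B}
      {x \<in> topspace L. x n \<in> U} {x \<in> topspace L. x n \<in> V}"
    unfolding admissible_def
    by (auto intro: closedin_continuous_map_preimage[OF continuous_projection]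
        openin_continuous_map_preimage[OF continuous_projection])
  then show "crooked_at L {x \<in> topspace L. limit_projection n x \<in> A} {x \<in> topspace L. limit_projection n x \<in> B}
      {x \<in> topspace L. limit_projection n x \<in> U} {x \<in> topspace L. limit_projection n x \<in> V}"
    using assms unfolding crooked_space_def limit_projection_def by blast
qed

text \<open>At a common late stage, the images of \<open>A\<close> and \<open>B\<close> are compact,
  hence closed, and have open neighbourhoods whose preimages lie in \<open>U\<close> and
  \<open>V\<close>. This quadruple pulls back to larger closed sets and smaller neighbourhoods, so
  monotonicity applies.\<close>

lemma crooked_projections_imp_crooked_space:
  assumes "\<And>n. crooked_map L (T n) (limit_projection n)"
  shows "crooked_space L"
  unfolding crooked_space_def
proof (intro allI impI)
  fix A B U V
  assume "admissible L A B U V"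
  then have ad: "closedin L A" "closedin L B" "openin L U" "openin L V" "A \<subseteq> U" "B \<subseteq> V"
    by (auto simp: admissible_def)
  obtain N1 where N1: "\<And>m. N1 \<le> m \<Longrightarrow> \<exists>W. openin (T m) W \<and> (\<forall>x\<in>A. x m \<in> W) \<and> (\<forall>x\<in>topspace L. x m \<in> W \<longrightarrow> x \<in> U)"
    using closed_in_open_factor[OF ad(1,3,5)] by blast
  obtain N2 where N2: "\<And>m. N2 \<le> m \<Longrightarrow> \<exists>W. openin (T m) W \<and> (\<forall>x\<in>B. x m \<in> W) \<and> (\<forall>x\<in>topspace L. x m \<in> W \<longrightarrow> x \<in> V)"
    using closed_in_open_factor[OF ad(2,4,6)] by blast
  define m where "m = max N1 N2"
  obtain W1 where W1: "openin (T m) W1" "\<forall>x\<in>A. x m \<in> W1" "\<forall>x\<in>topspace L. x m \<in> W1 \<longrightarrow> x \<in> U"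
    using N1[of m] by (auto simp: m_def)
  obtain W2 where W2: "openin (T m) W2" "\<forall>x\<in>B. x m \<in> W2" "\<forall>x\<in>topspace L. x m \<in> W2 \<longrightarrow> x \<in> V"
    using N2[of m] by (auto simp: m_def)
  have closed_image: "closedin (T m) ((\<lambda>x. x m) ` S)" if "closedin L S" for S
    using image_compactin[OF closedin_compact_space[OF compact_L that] continuous_projection]
      compactin_imp_closedin[OF Hausdorff_T] by blast
  have "admissible (T m) ((\<lambda>x. x m) ` A) ((\<lambda>x. x m) ` B) W1 W2"
    unfolding admissible_def using closed_image ad W1 W2 by blast
  then have "crooked_map_at L (limit_projection m) ((\<lambda>x. x m) ` A) ((\<lambda>x. x m) ` B) W1 W2"
    using assms unfolding crooked_map_def by blast
  then show "crooked_at L A B U V"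
    unfolding crooked_map_at_def
    by (rule crooked_at_mono)
      (use W1 W2 closedin_subset[OF ad(1)] closedin_subset[OF ad(2)] in \<open>auto simp: limit_projection_def\<close>)
qed

lemma crooked_projections_imp_eps_crooked_at:
  assumes "crooked_map L (T n) (limit_projection n)" "\<epsilon> > 0" "closedin (T n) A" "closedin (T n) B"
  shows "\<exists>m\<ge>n. eps_crooked_at (T m) (X n) (b n m) \<epsilon> A B"
  unfolding eps_crooked_at_def
proof (rule crooked_at_finite_stage[OF assms(3,4)])
  show "openin (T n) (set_nbhd (X n) \<epsilon> A)" "openin (T n) (set_nbhd (X n) \<epsilon> B)"
    using assms closedin_subset by (fastforce intro: openin_set_nbhd)+
  show "crooked_map_at L (limit_projection n) A B (set_nbhd (X n) \<epsilon> A) (set_nbhd (X n) \<epsilon> B)"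
    using assms admissible_set_nbhd unfolding crooked_map_def by blast
qed

text \<open>By compactness the given neighbourhoods contain metric ones, and the smaller radius
  serves both. Crookedness at stage \<open>m\<close> pulls back along the \<open>m\<close>-th
  projection.\<close>

lemma eps_crooked_at_imp_crooked_projection:
  assumes ec: "\<And>\<epsilon> A B. \<epsilon> > 0 \<Longrightarrow> closedin (T n) A \<Longrightarrow> closedin (T n) B \<Longrightarrow>
      \<exists>m\<ge>n. eps_crooked_at (T m) (X n) (b n m) \<epsilon> A B"
  shows "crooked_map L (T n) (limit_projection n)"
  unfolding crooked_map_def
proof (intro allI impI)
  fix A B U V
  assume "admissible (T n) A B U V"
  then have ad: "closedin (T n) A" "closedin (T n) B" "openin (T n) U" "openin (T n) V" "A \<subseteq> U" "B \<subseteq> V"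
    by (auto simp: admissible_def)
  obtain \<delta>1 where d1: "\<delta>1 > 0" "set_nbhd (X n) \<delta>1 A \<subseteq> U"
    using set_nbhd_subset_open[OF closedin_compact_space[OF compact_T ad(1)] ad(3,5)] .
  obtain \<delta>2 where d2: "\<delta>2 > 0" "set_nbhd (X n) \<delta>2 B \<subseteq> V"
    using set_nbhd_subset_open[OF closedin_compact_space[OF compact_T ad(2)] ad(4,6)] .
  obtain m where m: "n \<le> m" "eps_crooked_at (T m) (X n) (b n m) (min \<delta>1 \<delta>2) A B"
    using ec[of "min \<delta>1 \<delta>2" A B] d1(1) d2(1) ad(1,2) by auto
  have "crooked_map_at L (limit_projection n) A B (set_nbhd (X n) (min \<delta>1 \<delta>2) A) (set_nbhd (X n) (min \<delta>1 \<delta>2) B)"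
    using m(2) unfolding eps_crooked_at_def
    by (rule crooked_map_at_compose[OF _ continuous_projection])
      (use m(1) in \<open>simp add: limit_projection_def bonding_thread\<close>)
  then show "crooked_map_at L (limit_projection n) A B U V"
    by (rule crooked_map_at_mono)
      (use d1 d2 set_nbhd_mono[of "min \<delta>1 \<delta>2" _ "X n"] in \<open>auto simp: subset_iff\<close>)
qed

text \<open>One half of \<epsilon> pays for replacing \<open>A\<close> and \<open>B\<close> by
  members of a finite family of closed sets, the other for crookedness at these members. Crookedness
  persists at later stages, so one stage serves the finitely many pairs.\<close>

lemma eps_crooked_at_imp_crooked_sequence:
  assumes ec: "\<And>n \<epsilon> A B. \<epsilon> > 0 \<Longrightarrow> closedin (T n) A \<Longrightarrow> closedin (T n) B \<Longrightarrow>
      \<exists>m\<ge>n. eps_crooked_at (T m) (X n) (b n m) \<epsilon> A B"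
  shows "crooked_sequence X f"
  unfolding crooked_sequence_def
proof (intro allI impI)
  fix n and \<epsilon> :: real
  assume e: "\<epsilon> > 0"
  obtain \<C> where \<C>: "finite \<C>" "\<And>C. C \<in> \<C> \<Longrightarrow> closedin (T n) C"
    "\<And>A. A \<subseteq> mspace (X n) \<Longrightarrow> \<exists>C \<in> \<C>. A \<subseteq> C \<and> C \<subseteq> set_nbhd (X n) (\<epsilon>/2) A"
    by (rule finite_closed_approximations[OF compact_T half_gt_zero[OF e]]) (rule that, simp_all)
  have "\<exists>m\<ge>n. \<forall>p\<in>\<C> \<times> \<C>. eps_crooked_at (T m) (X n) (b n m) (\<epsilon>/2) (fst p) (snd p)"
  proof (rule uniform_stage)
    show "finite (\<C> \<times> \<C>)"
      using \<C>(1) by simp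
    show "\<exists>m\<ge>n. eps_crooked_at (T m) (X n) (b n m) (\<epsilon>/2) (fst p) (snd p)" if "p \<in> \<C> \<times> \<C>" for p
      using that \<C>(2) e by (intro ec) auto
    show "eps_crooked_at (T k) (X n) (b n k) (\<epsilon>/2) (fst p) (snd p)"
      if "n \<le> m" "m \<le> k" "eps_crooked_at (T m) (X n) (b n m) (\<epsilon>/2) (fst p) (snd p)" for p m k
      using that(3) unfolding eps_crooked_at_def
      by (rule crooked_map_at_compose[OF _ continuous_bonding[OF that(2)]]) (use that bonding_trans in blast)
  qed
  then obtain m where m: "n \<le> m"
    "\<And>C D. C \<in> \<C> \<Longrightarrow> D \<in> \<C> \<Longrightarrow> eps_crooked_at (T m) (X n) (b n m) (\<epsilon>/2) C D"
    by fastforce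
  have "eps_crooked_at (T m) (X n) (b n m) \<epsilon> A B" if AB: "closedin (T n) A" "closedin (T n) B" for A B
  proof -
    have sub: "A \<subseteq> mspace (X n)" "B \<subseteq> mspace (X n)"
      using AB closedin_subset by fastforce+
    obtain C where C: "C \<in> \<C>" "A \<subseteq> C" "C \<subseteq> set_nbhd (X n) (\<epsilon>/2) A"
      using \<C>(3)[OF sub(1)] by blast
    obtain D where D: "D \<in> \<C>" "B \<subseteq> D" "D \<subseteq> set_nbhd (X n) (\<epsilon>/2) B"
      using \<C>(3)[OF sub(2)] by blast
    have "set_nbhd (X n) (\<epsilon>/2) C \<subseteq> set_nbhd (X n) \<epsilon> A" "set_nbhd (X n) (\<epsilon>/2) D \<subseteq> set_nbhd (X n) \<epsilon> B"
      using set_nbhd_set_nbhd[OF sub(1) C(3), of "\<epsilon>/2"] set_nbhd_set_nbhd[OF sub(2) D(3), of "\<epsilon>/2"] by auto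
    then show ?thesis
      using crooked_map_at_mono[OF m(2)[OF C(1) D(1), unfolded eps_crooked_at_def] C(2) D(2)]
      unfolding eps_crooked_at_def by blast
  qed
  then show "\<exists>m\<ge>n. eps_crooked (T m) (X n) (b n m) \<epsilon>"
    using m(1) unfolding eps_crooked_def by blast
qed

end

theorem theorem2p18:
  fixes X :: "nat \<Rightarrow> 'a metric" and f :: "nat \<Rightarrow> 'a \<Rightarrow> 'a"
  assumes "inverse_sequence X f"
  shows
    "(hereditarily_indecomposable (inverse_limit X f) \<longleftrightarrow> crooked_space (inverse_limit X f)) \<and>
     (crooked_space (inverse_limit X f) \<longleftrightarrow>
       (\<forall>n. crooked_map (inverse_limit X f) (mtopology_of (X n)) (limit_projection n))) \<and>
     ((\<forall>n. crooked_map (inverse_limit X f) (mtopology_of (X n)) (limit_projection n)) \<longleftrightarrow>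
       (\<forall>n. \<forall>\<epsilon>>0. \<forall>A B. closedin (mtopology_of (X n)) A \<longrightarrow> closedin (mtopology_of (X n)) B \<longrightarrow>
          (\<exists>m\<ge>n. eps_crooked_at (mtopology_of (X m)) (X n) (bonding_map f n m) \<epsilon> A B))) \<and>
     ((\<forall>n. \<forall>\<epsilon>>0. \<forall>A B. closedin (mtopology_of (X n)) A \<longrightarrow> closedin (mtopology_of (X n)) B \<longrightarrow>
          (\<exists>m\<ge>n. eps_crooked_at (mtopology_of (X m)) (X n) (bonding_map f n m) \<epsilon> A B)) \<longleftrightarrow>
       crooked_sequence X f)"
proof (intro conjI)
  interpret compact_inverse_sequence X f
    by unfold_locales (rule assms)
  let ?iv = "\<forall>n. \<forall>\<epsilon>>0. \<forall>A B. closedin (T n) A \<longrightarrow> closedin (T n) B \<longrightarrow>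
          (\<exists>m\<ge>n. eps_crooked_at (T m) (X n) (b n m) \<epsilon> A B)"
  show "hereditarily_indecomposable L \<longleftrightarrow> crooked_space L"
    using hereditarily_indecomposable_imp_crooked_space[OF compact_L Hausdorff_L]
      crooked_space_imp_hereditarily_indecomposable[OF Hausdorff_L] by blast
  show "crooked_space L \<longleftrightarrow> (\<forall>n. crooked_map L (T n) (limit_projection n))"
    using crooked_space_imp_crooked_projection crooked_projections_imp_crooked_space by blast
  show "(\<forall>n. crooked_map L (T n) (limit_projection n)) \<longleftrightarrow> ?iv"
    using crooked_projections_imp_eps_crooked_at eps_crooked_at_imp_crooked_projection by auto
  show "?iv \<longleftrightarrow> crooked_sequence X f"
  proof
    show "?iv \<Longrightarrow> crooked_sequence X f"
      by (rule eps_crooked_at_imp_crooked_sequence) blast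
    show "crooked_sequence X f \<Longrightarrow> ?iv"
      unfolding crooked_sequence_def eps_crooked_def by blast
  qed
qed

end
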